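(* Let $X$ be a Radon plane, let $\gamma:[0,L]\to S_X$ be the continuous Minkowski arc-length parametrization of its unit circle, and for each $s$ let $r(s)$ be the parameter, unique up to replacing $\gamma(r(s))$ by its antipode, such that $\gamma(s)\perp_B\gamma(r(s))$. Then $$\mathrm{DR}_B(X)=\sup_{s\in[0,L/2]}\ \sup_{t>0}\ \max\left\{\frac{\|\gamma(s)-\gamma(r(s))\|}{\|t\gamma(s)-t^{-1}\gamma(r(s))\|},\ \frac{\|\gamma(s)+\gamma(r(s))\|}{\|t\gamma(s)+t^{-1}\gamma(r(s))\|}\right\}.$$
   Context: A Radon plane is a two-dimensional real normed space in which Birkhoff orthogonality is symmetric, where $x\perp_B y$ iff $\|x+\lambda y\|\ge\|x\|$ for all $\lambda\in\mathbb R$. $S_X$ is the unit circle, $L$ is its length measured in the norm of $X$, and $\gamma$ traverses $S_X$ once ($\gamma(0)=\gamma(L)$). The existence and uniqueness (up to antipodes) of $r(s)$ for every $s$ is part of the setup. For nonzero $x,y\in X$ put $\alpha[x,y]=\left\|\frac{x}{\|x\|}-\frac{y}{\|y\|}\right\|$ and $\beta[x,y]=\left\|\frac{x}{\|y\|}-\frac{y}{\|x\|}\right\|$, and $$\mathrm{DR}_B(X)=\sup\left\{\frac{\alpha[x,y]}{\beta[x,y]}: x,y\in X\setminus\{0\},\ x\perp_B y,\ \beta[x,y]\ne 0\right\}.$$ *)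

theory Defs
  imports "HOL-Analysis.Analysis"
begin

definition birkhoff_orth :: "'a::real_normed_vector \<Rightarrow> 'a \<Rightarrow> bool"  (infix "\<bottom>\<^sub>B" 50)
  where "x \<bottom>\<^sub>B y \<longleftrightarrow> (\<forall>l::real. norm (x + l *\<^sub>R y) \<ge> norm x)"

definition radon_plane :: "'a::real_normed_vector itself \<Rightarrow> bool"
  where "radon_plane _ \<longleftrightarrow>
    dim (UNIV :: 'a set) = 2 \<and> (\<forall>x y :: 'a. x \<bottom>\<^sub>B y \<longrightarrow> y \<bottom>\<^sub>B x)"

definition alpha :: "'a::real_normed_vector \<Rightarrow> 'a \<Rightarrow> real"
  where "alpha x y = norm (x /\<^sub>R norm x - y /\<^sub>R norm y)"

definition beta :: "'a::real_normed_vector \<Rightarrow> 'a \<Rightarrow> real"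
  where "beta x y = norm (x /\<^sub>R norm y - y /\<^sub>R norm x)"

text \<open>The supremum is taken over a set of reals that is always bounded above;
  see \<open>bdd_above_DR_B\<close> below.\<close>

definition DR_B :: "'a::real_normed_vector itself \<Rightarrow> real"
  where "DR_B _ = Sup {alpha x y / beta x y | x y :: 'a.
    x \<noteq> 0 \<and> y \<noteq> 0 \<and> x \<bottom>\<^sub>B y \<and> beta x y \<noteq> 0}"

text \<open>Length of the curve \<open>g\<close> on \<open>[a, b]\<close>, measured in the norm: the supremum of the lengths of
  inscribed polygons with vertices \<open>g (p 0), \<dots>, g (p n)\<close>, where
  \<open>a = p 0 \<le> p 1 \<le> \<dots> \<le> p n = b\<close>. It is extended-real valued, so that a finite value
  entails rectifiability.\<close>

definition curve_length :: "(real \<Rightarrow> 'a::real_normed_vector) \<Rightarrow> real \<Rightarrow> real \<Rightarrow> ereal"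
  where "curve_length g a b =
    Sup {ereal (\<Sum>i<n. norm (g (p (Suc i)) - g (p i))) | (n::nat) p.
      mono_on {..n} p \<and> p 0 = a \<and> p n = b}"

text \<open>The last conjunct, for \<open>s = 0\<close> and \<open>t = L\<close>, says that \<open>L\<close> is the length of
  the unit circle.\<close>

definition arclength_unit_circle :: "real \<Rightarrow> (real \<Rightarrow> 'a::real_normed_vector) \<Rightarrow> bool"
  where "arclength_unit_circle L \<gamma> \<longleftrightarrow>
    continuous_on {0..L} \<gamma> \<and>
    \<gamma> ` {0..L} = sphere 0 1 \<and>
    inj_on \<gamma> {0..<L} \<and>
    \<gamma> 0 = \<gamma> L \<and>
    (\<forall>s t. 0 \<le> s \<and> s \<le> t \<and> t \<le> L \<longrightarrow> curve_length \<gamma> s t = ereal (t - s))"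

text \<open>\<open>r\<close> picks, for each parameter \<open>s\<close>, a parameter of the direction Birkhoff orthogonal to
  \<open>\<gamma> s\<close>; that this direction is unique up to antipodes is part of the predicate.\<close>

definition orth_param :: "real \<Rightarrow> (real \<Rightarrow> 'a::real_normed_vector) \<Rightarrow> (real \<Rightarrow> real) \<Rightarrow> bool"
  where "orth_param L \<gamma> r \<longleftrightarrow>
    (\<forall>s\<in>{0..L}. r s \<in> {0..L} \<and> \<gamma> s \<bottom>\<^sub>B \<gamma> (r s) \<and>
      (\<forall>u\<in>{0..L}. \<gamma> s \<bottom>\<^sub>B \<gamma> u \<longrightarrow> \<gamma> u = \<gamma> (r s) \<or> \<gamma> u = - \<gamma> (r s)))"

lemma birkhoff_unit_ratio_le:
  fixes u v :: "'a::real_normed_vector"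
  assumes "norm u = 1" "norm v = 1" "u \<bottom>\<^sub>B v" "t > 0"
  shows "norm (u - v) / norm (t *\<^sub>R u - inverse t *\<^sub>R v) \<le> 4"
    and "norm (u + v) / norm (t *\<^sub>R u + inverse t *\<^sub>R v) \<le> 4"
proof -
  have main: "norm (u + c *\<^sub>R v) / norm (t *\<^sub>R u + (c * inverse t) *\<^sub>R v) \<le> 4"
    if c: "\<bar>c\<bar> = 1" for c :: real
  proof -
    define N where "N = norm (t *\<^sub>R u + (c * inverse t) *\<^sub>R v)"
    have "t *\<^sub>R u + (c * inverse t) *\<^sub>R v = t *\<^sub>R (u + (c * inverse t * inverse t) *\<^sub>R v)"
      using assms(4) by (simp add: scaleR_add_right)
    hence "N = t * norm (u + (c * inverse t * inverse t) *\<^sub>R v)"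
      using assms(4) by (simp add: N_def)
    moreover have "norm (u + (c * inverse t * inverse t) *\<^sub>R v) \<ge> 1"
      using assms(1,3) unfolding birkhoff_orth_def by metis
    ultimately have Nt: "N \<ge> t" using assms(4) by simp
    have "norm ((c * inverse t) *\<^sub>R v) \<le> N + norm (t *\<^sub>R u)"
      unfolding N_def by (metis add.commute add_diff_cancel norm_triangle_ineq4)
    hence "inverse t \<le> N + t"
      using assms c by (simp add: abs_mult)
    hence i: "inverse t \<le> 2 * N" using Nt by simp
    have "N \<ge> 1/2"
    proof (rule ccontr)
      assume "\<not> N \<ge> 1/2"
      hence "t < 1" "inverse t < 1" using Nt i by auto
      thus False using assms(4) one_less_inverse[of t] by simp
    qed
    moreover have "norm (u + c *\<^sub>R v) \<le> 2"
      using norm_triangle_ineq[of u "c *\<^sub>R v"] assms c by simp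
    ultimately show ?thesis unfolding N_def[symmetric] by (simp add: divide_simps)
  qed
  show "norm (u - v) / norm (t *\<^sub>R u - inverse t *\<^sub>R v) \<le> 4" using main[of "-1"] by simp
  show "norm (u + v) / norm (t *\<^sub>R u + inverse t *\<^sub>R v) \<le> 4" using main[of 1] by simp
qed

lemma bdd_above_DR_B:
  "bdd_above {alpha x y / beta x y | x y :: 'a::real_normed_vector.
    x \<noteq> 0 \<and> y \<noteq> 0 \<and> x \<bottom>\<^sub>B y \<and> beta x y \<noteq> 0}"
proof (rule bdd_aboveI[where M = 4], clarify)
  fix x y :: 'a
  assume xy: "x \<noteq> 0" "y \<noteq> 0" "x \<bottom>\<^sub>B y"
  define u v where "u = x /\<^sub>R norm x" and "v = y /\<^sub>R norm y"
  have uv: "norm u = 1" "norm v = 1" using xy by (auto simp: u_def v_def)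
  have "norm (u + l *\<^sub>R v) \<ge> norm u" for l
  proof -
    have "u + l *\<^sub>R v = (x + (l * norm x / norm y) *\<^sub>R y) /\<^sub>R norm x"
      using xy by (simp add: u_def v_def scaleR_add_right field_simps)
    hence "norm (u + l *\<^sub>R v) = norm (x + (l * norm x / norm y) *\<^sub>R y) / norm x"
      by (simp only: norm_scaleR) (simp add: divide_inverse)
    moreover have "norm (x + (l * norm x / norm y) *\<^sub>R y) \<ge> norm x"
      using xy(3) by (simp add: birkhoff_orth_def)
    ultimately show ?thesis using xy(1) by (simp only: uv) simp
  qed
  hence "u \<bottom>\<^sub>B v" by (simp add: birkhoff_orth_def)
  from birkhoff_unit_ratio_le(1)[OF uv this, of "norm x / norm y"] xy
  show "alpha x y / beta x y \<le> 4"
    by (simp add: alpha_def beta_def u_def v_def field_simps)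
qed

end

theory Submission
  imports Defs
begin

text \<open>
  If \<open>\<gamma> a = - \<gamma> 0\<close>, the antipodal map carries the arc \<open>\<gamma> ` {0..a}\<close> onto the complementary arc
  \<open>\<gamma> ` {a..L}\<close>: it has no fixed point, so the induced parameter change can never return to
  \<open>{0..a}\<close>. Since it preserves length, \<open>a \<le> L - a\<close>, and so \<open>\<gamma> ` {0..L/2}\<close> meets every pair of
  antipodes. The ratio \<open>\<alpha>[x,y] / \<beta>[x,y]\<close> depends only on the directions of \<open>x\<close>, \<open>y\<close> and on
  \<open>t = \<parallel>x\<parallel> / \<parallel>y\<parallel>\<close>, and changing the sign of \<open>x\<close> or \<open>y\<close> exchanges the two terms of the maximum.
\<close>

lemma birkhoff_orth_scaleR:
  assumes "x \<bottom>\<^sub>B y"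
  shows "a *\<^sub>R x \<bottom>\<^sub>B b *\<^sub>R y"
proof (cases "a = 0")
  case False
  have "norm (a *\<^sub>R x) \<le> norm (a *\<^sub>R x + l *\<^sub>R b *\<^sub>R y)" for l
  proof -
    have "a *\<^sub>R x + l *\<^sub>R b *\<^sub>R y = a *\<^sub>R (x + (l * b / a) *\<^sub>R y)"
      using False by (simp add: scaleR_add_right)
    moreover have "norm x \<le> norm (x + (l * b / a) *\<^sub>R y)"
      using assms by (simp add: birkhoff_orth_def)
    ultimately show ?thesis
      by (simp add: mult_left_mono)
  qed
  then show ?thesis
    by (simp add: birkhoff_orth_def)
qed (simp add: birkhoff_orth_def)

text \<open>By homogeneity \<open>t *\<^sub>R x\<close> is orthogonal to
  \<open>c *\<^sub>R y\<close>, so the norm is at least that of \<open>t *\<^sub>R x\<close>. This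
  keeps the denominators of the ratios away from zero.\<close>

lemma birkhoff_orth_norm_pos:
  assumes "x \<bottom>\<^sub>B y" "x \<noteq> 0" "t > 0"
  shows "norm (t *\<^sub>R x + c *\<^sub>R y) > 0"
proof -
  have "norm (t *\<^sub>R x) \<le> norm (t *\<^sub>R x + 1 *\<^sub>R c *\<^sub>R y)"
    using birkhoff_orth_scaleR[OF assms(1), of t c] unfolding birkhoff_orth_def by blast
  then show ?thesis
    using assms(2,3) by (smt (verit) norm_scaleR scaleR_one zero_less_norm_iff mult_pos_pos)
qed

text \<open>Closed graph argument: the graph of \<open>f\<close> is the zero set of the continuous
  map sending (t, z) to g z - h t, and the codomain \<open>T\<close> is compact. It serves to show
  that the parameter of the antipode of \<gamma> t varies continuously with t.\<close>

lemma continuous_on_implicit: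
  fixes f :: "real \<Rightarrow> real" and g h :: "real \<Rightarrow> 'a::real_normed_vector"
  assumes "compact T" "continuous_on T g" "continuous_on S h"
    and f: "\<And>t. t \<in> S \<Longrightarrow> f t \<in> T" "\<And>t. t \<in> S \<Longrightarrow> g (f t) = h t"
    and uniq: "\<And>t z. t \<in> S \<Longrightarrow> z \<in> T \<Longrightarrow> g z = h t \<Longrightarrow> z = f t"
  shows "continuous_on S f"
proof -
  have "(\<lambda>x. (x, f x)) ` S = {p \<in> S \<times> T. g (snd p) - h (fst p) = 0}"
    using f uniq by (auto simp: image_iff)
  moreover have "continuous_on (S \<times> T) (\<lambda>p. g (snd p) - h (fst p))"
    using assms(2,3)
    by (intro continuous_on_diff continuous_on_compose2[OF assms(2)]
        continuous_on_compose2[OF assms(3)] continuous_intros) auto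
  ultimately have "closedin (top_of_set (S \<times> T)) ((\<lambda>x. (x, f x)) ` S)"
    using continuous_closedin_preimage_constant[of "S \<times> T" "\<lambda>p. g (snd p) - h (fst p)" 0] by simp
  then show ?thesis
    using continuous_closed_graph_eq[OF assms(1), of f S] f(1) by auto
qed

text \<open>A monotone \<open>f\<close> carries the vertices of a polygon inscribed in
  \<open>g\<close> to those of a polygon inscribed in \<open>h\<close> with the same edge lengths,
  so every length competing on the left also competes on the right.\<close>

lemma curve_length_le_reparam:
  assumes "mono_on {a..b} f"
    and iso: "\<And>s t. s \<in> {a..b} \<Longrightarrow> t \<in> {a..b} \<Longrightarrow> norm (h (f s) - h (f t)) = norm (g s - g t)"
  shows "curve_length g a b \<le> curve_length h (f a) (f b)"
  unfolding curve_length_def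
proof (rule Sup_subset_mono, rule subsetI)
  fix x assume "x \<in> {ereal (\<Sum>i<n. norm (g (p (Suc i)) - g (p i))) | (n::nat) p.
    mono_on {..n} p \<and> p 0 = a \<and> p n = b}"
  then obtain n p where x: "x = ereal (\<Sum>i<n. norm (g (p (Suc i)) - g (p i)))"
    and p: "mono_on {..n} p" "p 0 = a" "p n = b"
    by blast
  have ran: "p i \<in> {a..b}" if "i \<le> n" for i
    using that p by (auto simp: mono_on_def)
  have "mono_on {..n} (f \<circ> p)"
    using assms(1) p(1) ran by (auto simp: mono_on_def)
  moreover have "(\<Sum>i<n. norm (g (p (Suc i)) - g (p i))) =
      (\<Sum>i<n. norm (h ((f \<circ> p) (Suc i)) - h ((f \<circ> p) i)))"
    using ran by (intro sum.cong refl) (simp only: o_apply lessThan_iff Suc_leI less_imp_le iso)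
  ultimately show "x \<in> {ereal (\<Sum>i<n. norm (h (q (Suc i)) - h (q i))) | (n::nat) q.
      mono_on {..n} q \<and> q 0 = f a \<and> q n = f b}"
    using x p(2,3) by (intro CollectI exI[of _ n] exI[of _ "f \<circ> p"]) auto
qed

lemma half_circle_meets_antipodes:
  fixes \<gamma> :: "real \<Rightarrow> 'a::real_normed_vector"
  assumes "arclength_unit_circle L \<gamma>" and "norm u = 1"
  obtains s where "s \<in> {0..L/2}" "\<gamma> s = u \<or> \<gamma> s = - u"
proof -
  have cont: "continuous_on {0..L} \<gamma>" and img: "\<gamma> ` {0..L} = sphere 0 1"
    and inj: "inj_on \<gamma> {0..<L}" and closed: "\<gamma> 0 = \<gamma> L"
    and len: "\<And>s t. 0 \<le> s \<Longrightarrow> s \<le> t \<Longrightarrow> t \<le> L \<Longrightarrow> curve_length \<gamma> s t = ereal (t - s)"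
    using assms(1) by (auto simp: arclength_unit_circle_def)
  have unit: "norm (\<gamma> s) = 1" if "s \<in> {0..L}" for s
    using img that by (metis imageI mem_sphere_0)
  have surj: "\<exists>s\<in>{0..L}. \<gamma> s = v" if "norm v = 1" for v
    using img that by (metis imageE mem_sphere_0)
  have neg: "\<gamma> s \<noteq> - \<gamma> s" if "s \<in> {0..L}" for s
  proof
    assume "\<gamma> s = - \<gamma> s"
    then have "\<gamma> s = 0"
      by (metis eq_neg_iff_add_eq_0 scaleR_2 scaleR_eq_0_iff zero_neq_numeral)
    with unit[OF that] show False by simp
  qed
  have eqD: "s = t \<or> s = 0 \<and> t = L \<or> s = L \<and> t = 0"
    if "\<gamma> s = \<gamma> t" "s \<in> {0..L}" "t \<in> {0..L}" for s t
  proof -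
    have "s = t" if "s \<noteq> L" "t \<noteq> L"
      using that \<open>\<gamma> s = \<gamma> t\<close> \<open>s \<in> _\<close> \<open>t \<in> _\<close> inj by (auto simp: inj_on_def)
    moreover have "s = 0" if "t = L" "s \<noteq> L"
      using that \<open>\<gamma> s = \<gamma> t\<close> \<open>s \<in> _\<close> \<open>t \<in> _\<close> inj closed by (auto simp: inj_on_def)
    moreover have "t = 0" if "s = L" "t \<noteq> L"
      using that \<open>\<gamma> s = \<gamma> t\<close> \<open>s \<in> _\<close> \<open>t \<in> _\<close> inj closed by (auto simp: inj_on_def)
    ultimately show ?thesis by blast
  qed
  have L0: "0 \<le> L"
    using surj[OF assms(2)] by auto
  obtain a where a: "a \<in> {0..L}" "\<gamma> a = - \<gamma> 0"
    using surj[of "- \<gamma> 0"] unit[of 0] L0 by auto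
  have aL: "0 < a" "a < L"
    using a neg[of 0] neg[of L] closed L0 by (metis atLeastAtMost_iff order_le_less order_refl)+
  \<comment> \<open>The antipode of \<gamma> t has one parameter, except that \<gamma> 0 = \<gamma>
    L has the two parameters 0 and L. For t in [0, a] the choice falls on L, so that the parameter
    change \<phi> does not jump back to 0 at t = a.\<close>
  have "\<exists>z. z \<in> {0..L} \<and> \<gamma> z = - \<gamma> t \<and> (z = 0 \<longrightarrow> t \<notin> {0..a})" if t: "t \<in> {0..L}" for t
  proof -
    obtain z where z: "z \<in> {0..L}" "\<gamma> z = - \<gamma> t"
      using surj[of "- \<gamma> t"] unit[OF t] by auto
    show ?thesis
      using z closed L0 aL by (cases "z = 0") (auto intro: exI[of _ L])
  qed
  then obtain \<phi> where
    "\<forall>t\<in>{0..L}. \<phi> t \<in> {0..L} \<and> \<gamma> (\<phi> t) = - \<gamma> t \<and> (\<phi> t = 0 \<longrightarrow> t \<notin> {0..a})"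
    by metis
  then have \<phi>: "\<And>t. t \<in> {0..L} \<Longrightarrow> \<phi> t \<in> {0..L}"
      "\<And>t. t \<in> {0..L} \<Longrightarrow> \<gamma> (\<phi> t) = - \<gamma> t"
      "\<And>t. t \<in> {0..a} \<Longrightarrow> \<phi> t \<noteq> 0"
    using aL by force+
  have sub: "t \<in> {0..L}" if "t \<in> {0..a}" for t
    using that aL by auto
  have cneg: "continuous_on {0..a} (\<lambda>t. - \<gamma> t)"
    using aL by (intro continuous_intros continuous_on_subset[OF cont]) auto
  have ends: "t = a" if "t \<in> {0..L}" "\<gamma> t = - \<gamma> 0" for t
    using eqD[of t a] that a aL by auto
  have \<phi>0: "\<phi> 0 = a"
    using \<phi>[of 0] ends aL by auto
  have \<phi>a: "\<phi> a = L"
    using \<phi>[of a] eqD[of "\<phi> a" 0] a aL by auto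
  \<comment> \<open>The point \<open>a\<close> is left out at first: its antipode is \<gamma> 0 =
    \<gamma> L, so uniqueness of the parameter in [0, L] fails exactly there.\<close>
  have cont1: "continuous_on {0..<a} \<phi>"
  proof (rule continuous_on_implicit[OF _ cont continuous_on_subset[OF cneg]])
    fix t z assume tz: "t \<in> {0..<a}" "z \<in> {0..L}" "\<gamma> z = - \<gamma> t"
    have "\<gamma> z \<noteq> \<gamma> 0"
      using ends[of t] tz aL by (auto simp: minus_equation_iff)
    then show "z = \<phi> t"
      using eqD[of z "\<phi> t"] \<phi>[of t] tz aL closed by auto
  qed (use \<phi> aL in auto)
  \<comment> \<open>Since \<phi> 0 = a > 0, a failure would force \<phi> x = x for some x by the
    intermediate value theorem, making \<gamma> x its own antipode.\<close>
  have above: "t < \<phi> t" if t: "t \<in> {0..<a}" for t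
  proof (rule ccontr)
    assume "\<not> t < \<phi> t"
    moreover have "continuous_on {0..t} (\<lambda>x. x - \<phi> x)"
      using that by (intro continuous_intros continuous_on_subset[OF cont1]) auto
    ultimately obtain x where "0 \<le> x" "x \<le> t" "x - \<phi> x = 0"
      using IVT'[of "\<lambda>x. x - \<phi> x" 0 0 t] \<phi>0 aL t by auto
    then show False
      using \<phi>(2)[of x] neg[of x] t aL by auto
  qed
  \<comment> \<open>As \<open>\<phi>\<close> is an involution, \<open>\<phi> t < a\<close> would give \<open>t < \<phi> t < \<phi> (\<phi> t) = t\<close>.\<close>
  have ge: "a \<le> \<phi> t" if "t \<in> {0..a}" for t
  proof (rule ccontr)
    assume lt: "\<not> a \<le> \<phi> t"
    then have t: "t \<in> {0..<a}"
      using that \<phi>a aL by (cases "t = a") auto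
    have mem: "\<phi> t \<in> {0..<a}"
      using \<phi>(1)[OF sub[OF that]] lt by auto
    then have "\<gamma> (\<phi> (\<phi> t)) = \<gamma> t"
      using \<phi>(2)[of t] \<phi>(2)[of "\<phi> t"] sub that aL by auto
    then have "\<phi> (\<phi> t) = t \<or> t = 0"
      using eqD[of "\<phi> (\<phi> t)" t] \<phi>(1)[of "\<phi> t"] mem t aL by auto
    then show False
      using above[OF t] above[OF mem] mem \<phi>0 by auto
  qed
  \<comment> \<open>By \<open>ge\<close> the values lie in [a, L], which excludes 0; there the
    parameter is unique even for t = a, so the closed graph argument now reaches the end
    point.\<close>
  have cont2: "continuous_on {0..a} \<phi>"
  proof (rule continuous_on_implicit[OF _ continuous_on_subset[OF cont] cneg])
    show "z = \<phi> t" if "t \<in> {0..a}" "z \<in> {a..L}" "\<gamma> z = - \<gamma> t" for t z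
      using eqD[of z "\<phi> t"] \<phi>[of t] ge[of t] that aL by auto
  qed (use \<phi> ge aL in auto)
  \<comment> \<open>Injectivity and continuity yield the monotonicity that the length comparison
    requires; the end values a < L show that \<phi> increases.\<close>
  have "inj_on \<phi> {0..a}"
  proof (rule inj_onI)
    fix s t assume st: "s \<in> {0..a}" "t \<in> {0..a}" "\<phi> s = \<phi> t"
    then have "\<gamma> s = \<gamma> t"
      using \<phi>(2) sub by (metis neg_equal_iff_equal)
    then show "s = t"
      using eqD[of s t] st aL by auto
  qed
  then have "strict_mono_on {0..a} \<phi> \<or> strict_antimono_on {0..a} \<phi>"
    using injective_eq_monotone_map[OF _ cont2] by (simp add: is_interval_cc)
  moreover have "\<not> strict_antimono_on {0..a} \<phi>"
    using \<phi>0 \<phi>a aL by (force simp: monotone_on_def)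
  ultimately have "mono_on {0..a} \<phi>"
    using strict_mono_on_imp_mono_on by blast
  then have "curve_length \<gamma> 0 a \<le> curve_length \<gamma> (\<phi> 0) (\<phi> a)"
  proof (rule curve_length_le_reparam)
    show "norm (\<gamma> (\<phi> s) - \<gamma> (\<phi> t)) = norm (\<gamma> s - \<gamma> t)" if "s \<in> {0..a}" "t \<in> {0..a}" for s t
      using \<phi>(2) sub that by (metis minus_diff_minus norm_minus_cancel)
  qed
  \<comment> \<open>The two arcs have lengths a and L - a. The inequality is enough, since it places
    [0, a] inside [0, L/2].\<close>
  then have half: "a \<le> L/2"
    using len[of 0 a] len[of a L] aL \<phi>0 \<phi>a by auto
  obtain s where s: "s \<in> {0..L}" "\<gamma> s = u"
    using surj assms(2) by blast
  show ?thesis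
  proof (cases "s \<le> a")
    case True
    then show ?thesis
      using s half by (intro that[of s]) auto
  next
    case False
    \<comment> \<open>Here s lies between \<phi> 0 = a and \<phi> a = L, so it is the antipodal
      parameter of some x in [0, a].\<close>
    then obtain x where x: "0 \<le> x" "x \<le> a" "\<phi> x = s"
      using IVT'[of \<phi> 0 s a] cont2 \<phi>0 \<phi>a s aL by auto
    then have "\<gamma> x = - u"
      using \<phi>(2)[of x] s aL by auto
    then show ?thesis
      using x half by (intro that[of x]) auto
  qed
qed

text \<open>The vectors have norms p and q, so dividing each by the norm of the other leaves the
  coefficients p/q and q/p. The quotient p/q is the t of the theorem.\<close>

lemma alpha_beta_unit:
  assumes "norm u = 1" "norm v = 1" "p > 0" "q > 0"
  shows "alpha (p *\<^sub>R u) (q *\<^sub>R v) = norm (u - v)"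
    and "beta (p *\<^sub>R u) (q *\<^sub>R v) = norm ((p / q) *\<^sub>R u - inverse (p / q) *\<^sub>R v)"
proof -
  have "norm (p *\<^sub>R u) = p" "norm (q *\<^sub>R v) = q"
    using assms by simp_all
  moreover have "inverse (p / q) = inverse p * q" "p / q = inverse q * p"
    by (simp_all add: divide_inverse mult.commute)
  ultimately show "alpha (p *\<^sub>R u) (q *\<^sub>R v) = norm (u - v)"
    and "beta (p *\<^sub>R u) (q *\<^sub>R v) = norm ((p / q) *\<^sub>R u - inverse (p / q) *\<^sub>R v)"
    using assms(3,4) by (simp_all only: alpha_def beta_def) simp_all
qed

text \<open>The pair \<open>t *\<^sub>R u\<close> and \<open>1 *\<^sub>R v\<close> has norm quotient
  t and realises this ratio. The same bound for -v covers the ratio with plus signs.\<close>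

lemma ratio_le_DR_B:
  fixes u v :: "'a::real_normed_vector"
  assumes "norm u = 1" "norm v = 1" "u \<bottom>\<^sub>B v" "t > 0"
  shows "norm (u - v) / norm (t *\<^sub>R u - inverse t *\<^sub>R v) \<le> DR_B TYPE('a)"
proof -
  have "norm (t *\<^sub>R u + (- inverse t) *\<^sub>R v) > 0"
    using assms by (intro birkhoff_orth_norm_pos) auto
  moreover have "t *\<^sub>R u \<bottom>\<^sub>B 1 *\<^sub>R v"
    using assms(3) by (rule birkhoff_orth_scaleR)
  moreover have "u \<noteq> 0" "v \<noteq> 0"
    using assms by auto
  ultimately show ?thesis
    unfolding DR_B_def using alpha_beta_unit[OF assms(1,2,4), of 1] assms(4)
    by (intro cSup_upper bdd_above_DR_B CollectI exI[of _ "t *\<^sub>R u"] exI[of _ "1 *\<^sub>R v"]) auto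
qed

theorem theorem4p5:
  fixes \<gamma> :: "real \<Rightarrow> 'a::real_normed_vector" and L :: real and r :: "real \<Rightarrow> real"
  assumes "radon_plane TYPE('a)"
    and "arclength_unit_circle L \<gamma>"
    and "orth_param L \<gamma> r"
  shows "DR_B TYPE('a) =
    (SUP s\<in>{0..L/2}. SUP t\<in>{0<..}.
      max (norm (\<gamma> s - \<gamma> (r s)) / norm (t *\<^sub>R \<gamma> s - inverse t *\<^sub>R \<gamma> (r s)))
          (norm (\<gamma> s + \<gamma> (r s)) / norm (t *\<^sub>R \<gamma> s + inverse t *\<^sub>R \<gamma> (r s))))"
proof -
  define F where "F s t =
      max (norm (\<gamma> s - \<gamma> (r s)) / norm (t *\<^sub>R \<gamma> s - inverse t *\<^sub>R \<gamma> (r s)))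
          (norm (\<gamma> s + \<gamma> (r s)) / norm (t *\<^sub>R \<gamma> s + inverse t *\<^sub>R \<gamma> (r s)))" for s t
  have img: "\<gamma> ` {0..L} = sphere 0 1"
    using assms(2) by (simp add: arclength_unit_circle_def)
  have orth: "s \<in> {0..L}" "norm (\<gamma> s) = 1" "norm (\<gamma> (r s)) = 1" "\<gamma> s \<bottom>\<^sub>B \<gamma> (r s)"
    if "s \<in> {0..L/2}" for s
  proof -
    show s: "s \<in> {0..L}" using that by auto
    then have "r s \<in> {0..L}" and "\<gamma> s \<bottom>\<^sub>B \<gamma> (r s)"
      using assms(3) by (auto simp: orth_param_def)
    then show "norm (\<gamma> s) = 1" "norm (\<gamma> (r s)) = 1" "\<gamma> s \<bottom>\<^sub>B \<gamma> (r s)"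
      using s img by (metis imageI mem_sphere_0)+
  qed
  \<comment> \<open>The first term of the maximum comes from \<gamma> (r s), the second from its
    negative, which is orthogonal to \<gamma> s as well.\<close>
  have F_le: "F s t \<le> DR_B TYPE('a)" if "s \<in> {0..L/2}" "t \<in> {0<..}" for s t
    using ratio_le_DR_B[OF orth(2,3,4)[OF that(1)], of t] that(2)
      ratio_le_DR_B[of "\<gamma> s" "- \<gamma> (r s)" t] orth(2,3)[OF that(1)]
      birkhoff_orth_scaleR[OF orth(4)[OF that(1)], of 1 "-1"]
    by (simp add: F_def)
  have inner_le: "(SUP t\<in>{0<..}. F s t) \<le> DR_B TYPE('a)" if "s \<in> {0..L/2}" for s
    using F_le[OF that] by (intro cSUP_least) auto
  \<comment> \<open>Suprema of reals are upper bounds only for bounded sets; \<open>DR_B\<close>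
    bounds both the inner and the outer one.\<close>
  have F_upper: "F s t \<le> (SUP s\<in>{0..L/2}. SUP t\<in>{0<..}. F s t)"
    if "s \<in> {0..L/2}" "t \<in> {0<..}" for s t
  proof -
    have "F s t \<le> (SUP t\<in>{0<..}. F s t)"
      using that F_le by (intro cSUP_upper bdd_aboveI2) auto
    also have "\<dots> \<le> (SUP s\<in>{0..L/2}. SUP t\<in>{0<..}. F s t)"
      using that(1) inner_le by (intro cSUP_upper[of s] bdd_aboveI2) auto
    finally show ?thesis .
  qed
  \<comment> \<open>Dimension two provides a nonzero vector, and its direction, up to sign, has a
    parameter in [0, L/2]. Hence neither side is a supremum over an empty set.\<close>
  obtain w :: 'a where "w \<noteq> 0"
  proof -
    obtain B :: "'a set" where "independent B" "card B = 2"
      using real_vector.basis_exists[of "UNIV :: 'a set"] assms(1)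
      unfolding radon_plane_def by metis
    then have "B \<noteq> {}" "0 \<notin> B"
      using real_vector.dependent_zero[of B] by auto
    then show ?thesis
      using that by (metis ex_in_conv)
  qed
  then have "norm (w /\<^sub>R norm w) = 1" by simp
  then obtain s\<^sub>0 where s0: "s\<^sub>0 \<in> {0..L/2}"
    using half_circle_meets_antipodes[OF assms(2)] by blast
  have "DR_B TYPE('a) \<le> (SUP s\<in>{0..L/2}. SUP t\<in>{0<..}. F s t)"
    unfolding DR_B_def
  proof (rule cSup_least)
    have "\<gamma> s\<^sub>0 \<bottom>\<^sub>B \<gamma> (r s\<^sub>0)" "\<gamma> s\<^sub>0 \<noteq> 0" "\<gamma> (r s\<^sub>0) \<noteq> 0"
      "norm (\<gamma> s\<^sub>0) = 1" "norm (\<gamma> (r s\<^sub>0)) = 1"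
      using orth[OF s0] by auto
    \<comment> \<open>For unit vectors \<open>beta\<close> is the norm of the difference, so this is
      the positivity lemma with t = 1 and c = -1.\<close>
    moreover have "norm (1 *\<^sub>R \<gamma> s\<^sub>0 + (-1) *\<^sub>R \<gamma> (r s\<^sub>0)) > 0"
      using calculation by (intro birkhoff_orth_norm_pos) auto
    ultimately show "{alpha x y / beta x y | x y :: 'a.
        x \<noteq> 0 \<and> y \<noteq> 0 \<and> x \<bottom>\<^sub>B y \<and> beta x y \<noteq> 0} \<noteq> {}"
      by (force simp: beta_def)
  next
    fix d assume "d \<in> {alpha x y / beta x y | x y :: 'a.
        x \<noteq> 0 \<and> y \<noteq> 0 \<and> x \<bottom>\<^sub>B y \<and> beta x y \<noteq> 0}"
    then obtain x y :: 'a where d: "d = alpha x y / beta x y"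
      and xy: "x \<noteq> 0" "y \<noteq> 0" "x \<bottom>\<^sub>B y" by blast
    define u v t where "u = x /\<^sub>R norm x" and "v = y /\<^sub>R norm y" and "t = norm x / norm y"
    have uv: "norm u = 1" "norm v = 1" and t: "t > 0"
      using xy by (auto simp: u_def v_def t_def)
    have "x = norm x *\<^sub>R u" "y = norm y *\<^sub>R v"
      using xy by (auto simp: u_def v_def)
    then have d': "d = norm (u - v) / norm (t *\<^sub>R u - inverse t *\<^sub>R v)"
      using alpha_beta_unit[OF uv, of "norm x" "norm y"] xy d by (simp add: t_def)
    obtain s where s: "s \<in> {0..L/2}" "\<gamma> s = u \<or> \<gamma> s = - u"
      using half_circle_meets_antipodes[OF assms(2) uv(1)] .
    obtain z where z: "z \<in> {0..L}" "\<gamma> z = v"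
      using uv(2) img by (metis imageE mem_sphere_0)
    \<comment> \<open>Both signs are recorded because \<gamma> s may be u or -u. In either case the
      uniqueness in \<open>orth_param\<close> identifies v with \<gamma> (r s) up to sign.\<close>
    have "u \<bottom>\<^sub>B v" "- u \<bottom>\<^sub>B v"
      using birkhoff_orth_scaleR[OF xy(3), of "inverse (norm x)" "inverse (norm y)"]
        birkhoff_orth_scaleR[OF xy(3), of "- inverse (norm x)" "inverse (norm y)"]
      by (simp_all add: u_def v_def)
    then have "\<gamma> s \<bottom>\<^sub>B \<gamma> z"
      using s z by auto
    then have v: "v = \<gamma> (r s) \<or> v = - \<gamma> (r s)"
      using assms(3) z orth(1)[OF s(1)] unfolding orth_param_def by metis
    have u: "u = \<gamma> s \<or> u = - \<gamma> s"
      using s(2) by auto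
    have neg_add: "norm (- p - q) = norm (p + q)" and neg_diff: "norm (- p + q) = norm (p - q)"
      for p q :: 'a
      using norm_minus_cancel[of "p + q"] norm_minus_cancel[of "p - q"] by simp_all
    \<comment> \<open>Of the four sign combinations, equal signs of u and v turn d into the first
      term of the maximum and opposite signs into the second.\<close>
    have "d \<le> F s t"
      using u v unfolding d' F_def
      by (elim disjE)
        (simp_all only: scaleR_minus_right neg_add neg_diff diff_minus_eq_add max.cobounded1 max.cobounded2)
    also have "\<dots> \<le> (SUP s\<in>{0..L/2}. SUP t\<in>{0<..}. F s t)"
      using s t by (intro F_upper) auto
    finally show "d \<le> (SUP s\<in>{0..L/2}. SUP t\<in>{0<..}. F s t)" .
  qed
  moreover have "(SUP s\<in>{0..L/2}. SUP t\<in>{0<..}. F s t) \<le> DR_B TYPE('a)"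
  proof (rule cSUP_least)
    show "{0..L/2} \<noteq> {}" using s0 by blast
  qed (rule inner_le)
  ultimately show ?thesis
    unfolding F_def by (rule antisym)
qed

end
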